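(* A residuated lattice $\mathcal{L}=(L,\vee,\wedge,\odot,\rightarrow,0,1)$ is idempotent (that is, $x\odot x=x$ for all $x\in L$) if and only if $\mathbf{S}(\mathcal{L}):=(L,\vee,\odot,0,1)$ is a bounded distributive lattice (with join $\vee$, meet $\odot$, least element $0$ and greatest element $1$).
   Context: A residuated lattice is an algebra $(L,\vee,\wedge,\odot,\rightarrow,0,1)$ of type $(2,2,2,2,0,0)$ such that $(L,\vee,\wedge,0,1)$ is a bounded lattice (with least element $0$ and greatest element $1$), $(L,\odot,1)$ is a commutative monoid, and for all $x,y,z\in L$: $x\odot y\leq z$ if and only if $x\leq y\rightarrow z$, where $\leq$ is the lattice order. *)

theory Defs
  imports Main
begin

text \<open>
  A lattice given as an algebra carries the order in which \<open>x \<le> y\<close> iff \<open>x \<squnion> y = y\<close>.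
  Deriving the order from the join alone makes it a function of the operations, so that the
  class predicates of \<open>Main\<close>, which take the order as a separate argument, apply to
  an algebra that has no order in its signature.
\<close>

definition join_le :: "('a \<Rightarrow> 'a \<Rightarrow> 'a) \<Rightarrow> 'a \<Rightarrow> 'a \<Rightarrow> bool" where
  "join_le join x y \<longleftrightarrow> join x y = y"

definition join_less :: "('a \<Rightarrow> 'a \<Rightarrow> 'a) \<Rightarrow> 'a \<Rightarrow> 'a \<Rightarrow> bool" where
  "join_less join x y \<longleftrightarrow> join_le join x y \<and> \<not> join_le join y x"

definition bounded_lattice_alg ::
    "('a \<Rightarrow> 'a \<Rightarrow> 'a) \<Rightarrow> ('a \<Rightarrow> 'a \<Rightarrow> 'a) \<Rightarrow> 'a \<Rightarrow> 'a \<Rightarrow> bool" where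
  "bounded_lattice_alg join meet bt tp \<longleftrightarrow>
     class.bounded_lattice meet (join_le join) (join_less join) join bt tp"

definition bounded_distrib_lattice_alg ::
    "('a \<Rightarrow> 'a \<Rightarrow> 'a) \<Rightarrow> ('a \<Rightarrow> 'a \<Rightarrow> 'a) \<Rightarrow> 'a \<Rightarrow> 'a \<Rightarrow> bool" where
  "bounded_distrib_lattice_alg join meet bt tp \<longleftrightarrow>
     bounded_lattice_alg join meet bt tp \<and>
     class.distrib_lattice meet (join_le join) (join_less join) join"

locale residuated_lattice =
  fixes join :: "'a \<Rightarrow> 'a \<Rightarrow> 'a"  (infixl "\<squnion>" 65)
    and meet :: "'a \<Rightarrow> 'a \<Rightarrow> 'a"  (infixl "\<sqinter>" 70)
    and mult :: "'a \<Rightarrow> 'a \<Rightarrow> 'a"  (infixl "\<odot>" 70)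
    and imp :: "'a \<Rightarrow> 'a \<Rightarrow> 'a"  (infixr "\<rightarrow>" 60)
    and zero :: 'a  ("\<zero>")
    and one :: 'a  ("\<one>")
  assumes bounded_lattice: "bounded_lattice_alg (\<squnion>) (\<sqinter>) \<zero> \<one>"
    and comm_monoid: "comm_monoid (\<odot>) \<one>"
    and residuation: "join_le (\<squnion>) (x \<odot> y) z \<longleftrightarrow> join_le (\<squnion>) x (y \<rightarrow> z)"

end

(*
  Residuation makes the product monotone and lets it distribute over joins. The product always lies
  below both factors, and a lower bound z of x and y satisfies z = z \<odot> z \<le> x \<odot> y once the
  product is idempotent. So an idempotent product is the meet, and distributes over joins.
*)

theory Submission
  imports Defs
begin

context residuated_lattice
begin

interpretation L: bounded_lattice "(\<sqinter>)" "join_le (\<squnion>)" "join_less (\<squnion>)" "(\<squnion>)" \<zero> \<one>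
  using bounded_lattice unfolding bounded_lattice_alg_def .

interpretation M: comm_monoid "(\<odot>)" \<one>
  by (rule comm_monoid)

text \<open>By residuation, multiplication by \<open>z\<close> is left adjoint to
  \<open>z \<rightarrow> _\<close>, and left adjoints preserve joins.\<close>

lemma mult_join_distrib: "(x \<squnion> y) \<odot> z = (x \<odot> z) \<squnion> (y \<odot> z)"
proof (rule L.order.antisym)
  show "join_le (\<squnion>) ((x \<squnion> y) \<odot> z) ((x \<odot> z) \<squnion> (y \<odot> z))"
    unfolding residuation by (intro L.le_supI; simp flip: residuation)
  \<comment> \<open>This is reflexivity of \<open>(x \<squnion> y) \<odot> z\<close>, residuated. It
    puts \<open>x\<close> and \<open>y\<close> separately below the implication, and residuating
    back bounds \<open>x \<odot> z\<close> and \<open>y \<odot> z\<close>.\<close>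
  have "join_le (\<squnion>) (x \<squnion> y) (z \<rightarrow> (x \<squnion> y) \<odot> z)"
    by (simp flip: residuation)
  then show "join_le (\<squnion>) ((x \<odot> z) \<squnion> (y \<odot> z)) ((x \<squnion> y) \<odot> z)"
    by (simp add: residuation)
qed

text \<open>The order is the equation \<open>x \<squnion> x' = x'\<close>, which distributivity
  carries over to products, one factor at a time.\<close>

lemma mult_mono:
  assumes "join_le (\<squnion>) x x'" and "join_le (\<squnion>) y y'"
  shows "join_le (\<squnion>) (x \<odot> y) (x' \<odot> y')"
proof -
  have "join_le (\<squnion>) (x \<odot> y) (x' \<odot> y)"
    using assms(1) mult_join_distrib[of x x' y] by (simp add: join_le_def)
  moreover have "join_le (\<squnion>) (x' \<odot> y) (x' \<odot> y')"
    using assms(2) mult_join_distrib[of y y' x'] by (simp add: join_le_def M.commute)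
  ultimately show ?thesis
    by (rule L.order.trans)
qed

text \<open>The monoid unit is also the top element, so monotonicity gives
  \<open>x \<odot> y \<le> x \<odot> \<one> = x\<close>.\<close>

lemma mult_le_left: "join_le (\<squnion>) (x \<odot> y) x"
  using mult_mono[OF L.order.refl L.top_greatest, of x y] by simp

lemma mult_le_right: "join_le (\<squnion>) (x \<odot> y) y"
  using mult_le_left[of y x] by (simp add: M.commute)

lemma mult_eq_meet_if_idempotent:
  assumes idem: "\<And>x. x \<odot> x = x"
  shows "(\<odot>) = (\<sqinter>)"
proof (intro ext L.order.antisym)
  fix x y
  show "join_le (\<squnion>) (x \<odot> y) (x \<sqinter> y)"
    by (simp add: mult_le_left mult_le_right)
  show "join_le (\<squnion>) (x \<sqinter> y) (x \<odot> y)"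
    using mult_mono[OF L.inf_le1 L.inf_le2, of x y x y] by (simp add: idem)
qed

lemma bounded_distrib_lattice_if_idempotent:
  assumes "\<And>x. x \<odot> x = x"
  shows "bounded_distrib_lattice_alg (\<squnion>) (\<odot>) \<zero> \<one>"
proof -
  have mult_eq_meet: "(\<odot>) = (\<sqinter>)"
    using assms by (rule mult_eq_meet_if_idempotent)
  have "z \<sqinter> (x \<squnion> y) = (z \<sqinter> x) \<squnion> (z \<sqinter> y)" for x y z
    using mult_join_distrib[of x y z] by (simp add: mult_eq_meet L.inf_commute)
  \<comment> \<open>The class axiom asks for joins distributing over meets, the dual of the law
    obtained from residuation; in a lattice either law implies the other.\<close>
  then have "x \<squnion> (y \<sqinter> z) = (x \<squnion> y) \<sqinter> (x \<squnion> z)" for x y z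
    by (rule L.distrib_imp1)
  then have "class.distrib_lattice (\<sqinter>) (join_le (\<squnion>)) (join_less (\<squnion>)) (\<squnion>)"
    by unfold_locales
  then show ?thesis
    using bounded_lattice by (simp add: bounded_distrib_lattice_alg_def mult_eq_meet)
qed

end

text \<open>Stated for an arbitrary \<open>meet\<close> so that \<open>\<odot>\<close> can take its
  place, which yields the converse direction.\<close>

lemma bounded_lattice_alg_meet_idem:
  assumes "bounded_lattice_alg join meet bt tp"
  shows "meet x x = x"
proof -
  interpret bounded_lattice meet "join_le join" "join_less join" join bt tp
    using assms unfolding bounded_lattice_alg_def .
  show ?thesis
    by (rule inf_idem)
qed

theorem theorem17:
  fixes join :: "'a \<Rightarrow> 'a \<Rightarrow> 'a"  (infixl "\<squnion>" 65)
    and meet :: "'a \<Rightarrow> 'a \<Rightarrow> 'a"  (infixl "\<sqinter>" 70)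
    and mult :: "'a \<Rightarrow> 'a \<Rightarrow> 'a"  (infixl "\<odot>" 70)
    and imp :: "'a \<Rightarrow> 'a \<Rightarrow> 'a"  (infixr "\<rightarrow>" 60)
    and zero :: 'a  ("\<zero>")
    and one :: 'a  ("\<one>")
  assumes "residuated_lattice (\<squnion>) (\<sqinter>) (\<odot>) (\<rightarrow>) \<zero> \<one>"
  shows "(\<forall>x. x \<odot> x = x) \<longleftrightarrow> bounded_distrib_lattice_alg (\<squnion>) (\<odot>) \<zero> \<one>"
proof
  assume "\<forall>x. x \<odot> x = x"
  with assms show "bounded_distrib_lattice_alg (\<squnion>) (\<odot>) \<zero> \<one>"
    by (simp add: residuated_lattice.bounded_distrib_lattice_if_idempotent)
next
  assume "bounded_distrib_lattice_alg (\<squnion>) (\<odot>) \<zero> \<one>"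
  then show "\<forall>x. x \<odot> x = x"
    by (auto simp: bounded_distrib_lattice_alg_def intro: bounded_lattice_alg_meet_idem)
qed

end
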